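(* Let $b_1,\dots,b_m$ be distinct integers, $w_1,\dots,w_m>0$ real weights, $P(X)=\sum_{\ell=1}^m w_\ell X^{b_\ell}$, and $c=-\min_\ell b_\ell\ge1$. For $z\ne0$ in a neighbourhood of zero let $X_1,\dots,X_c$ be the $c$ small solutions of the characteristic equation $1-zP(X)=0$, and let $T(z)=\frac{1}{1-zP(1)}$. Then a family of solutions of the system of recurrence relations $$T_j(z)=1+z\sum_{\ell=1}^{m}w_\ell T_{j+b_\ell}(z),\qquad j\ge0,$$ well defined for $z\neq 0$ in a neighbourhood of zero, is given by $$T_j(z)=T(z)\Big(1-\sum_{\ell=1}^{c}\alpha_\ell X_\ell^j\Big),\qquad j\ge -c,$$ with free parameters $\alpha_\ell$, $1\le\ell\le c$. The parameters $\alpha_\ell$ are independent of $j$, but may depend on $X_1,\dots,X_c$ and $z$.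
   Context: For $z\neq0$ near zero, the characteristic equation $1-zP(X)=0$ has exactly $c$ solutions $X_1(z),\dots,X_c(z)$ that tend to $0$ as $z\to0$; these are called the small solutions. They satisfy $|X_\ell(z)|<1$ for $z$ near $0$, are nonzero, and are given near $0$ by $X_\ell(z)=\omega^{\ell-1}z^{1/c}A(\omega^{\ell-1}z^{1/c})$ with $\omega=e^{2\pi i/c}$ and $A$ analytic and nonzero at $0$. *)

theory Defs
  imports "HOL-Complex_Analysis.Complex_Analysis"
begin

definition laurent_P :: "nat \<Rightarrow> (nat \<Rightarrow> real) \<Rightarrow> (nat \<Rightarrow> int) \<Rightarrow> complex \<Rightarrow> complex" where
  "laurent_P m w b X = (\<Sum>l=1..m. complex_of_real (w l) * X powi b l)"

text \<open>
  Since \<open>0 powi k = 0\<close> for \<open>k < 0\<close>, the point \<open>0\<close>, where a Laurent polynomial with a pole is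
  undefined, is excluded explicitly.
\<close>

definition char_solutions :: "(complex \<Rightarrow> complex) \<Rightarrow> complex \<Rightarrow> complex set" where
  "char_solutions P z = {x. x \<noteq> 0 \<and> 1 - z * P x = 0}"

text \<open>
  The functions \<open>X 1, \<dots>, X c\<close> tend to \<open>0\<close> as \<open>z \<rightarrow> 0\<close> and, for every \<open>z \<noteq> 0\<close> near \<open>0\<close>, their
  values enumerate without repetition all solutions inside a fixed disc around \<open>0\<close>. Thus they are
  exactly the solutions that tend to \<open>0\<close>; every other solution stays bounded away from \<open>0\<close>.
  No choice of a branch of the \<open>c\<close>-th root is made: the numbering may vary with \<open>z\<close>.
\<close>

definition small_solutions ::
    "(complex \<Rightarrow> complex) \<Rightarrow> nat \<Rightarrow> (nat \<Rightarrow> complex \<Rightarrow> complex) \<Rightarrow> bool" where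
  "small_solutions P c X \<longleftrightarrow>
     (\<forall>l\<in>{1..c}. (X l \<longlongrightarrow> 0) (at 0)) \<and>
     (\<exists>\<delta>>0. \<forall>\<^sub>F z in at 0.
        bij_betw (\<lambda>l. X l z) {1..c} (char_solutions P z \<inter> ball 0 \<delta>))"

definition total_T :: "(complex \<Rightarrow> complex) \<Rightarrow> complex \<Rightarrow> complex" where
  "total_T P z = 1 / (1 - z * P 1)"

end

theory Submission imports Defs begin

text \<open>
  The recurrence is affine in \<open>(T\<^sub>j)\<close>, the constant sequence \<open>T(z)\<close> solves it, and \<open>x\<^sup>j\<close> solves its
  homogeneous part for every nonzero root \<open>x\<close> of the characteristic equation.
\<close>

text \<open>Exponents may be negative, and \<open>x \<noteq> 0\<close> makes \<open>powi\<close>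
  turn sums of exponents into products, so \<open>x powi j\<close> factors out.\<close>

lemma laurent_P_shift:
  assumes "x \<noteq> 0"
  shows "(\<Sum>l=1..m. complex_of_real (w l) * x powi (j + b l)) = x powi j * laurent_P m w b x"
  using assms by (simp add: laurent_P_def power_int_add sum_distrib_left mult_ac)

lemma char_solution_shift:
  assumes "x \<in> char_solutions (laurent_P m w b) z"
  shows "z * (\<Sum>l=1..m. complex_of_real (w l) * x powi (j + b l)) = x powi j"
proof -
  have "x \<noteq> 0" and "z * laurent_P m w b x = 1"
    using assms by (auto simp: char_solutions_def)
  then show ?thesis
    by (simp add: laurent_P_shift mult.left_commute del: One_nat_def)
qed

text \<open>The algebraic core at one fixed \<open>z\<close>: the coefficients
  \<open>\<alpha> k\<close> are plain numbers here, so they may later depend on \<open>z\<close> in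
  any way.\<close>

lemma recurrence_char_solutions:
  fixes \<alpha> x :: "'i \<Rightarrow> complex"
  assumes nz: "1 - z * laurent_P m w b 1 \<noteq> 0"
    and sol: "\<And>k. k \<in> I \<Longrightarrow> x k \<in> char_solutions (laurent_P m w b) z"
  defines "T \<equiv> \<lambda>j. total_T (laurent_P m w b) z * (1 - (\<Sum>k\<in>I. \<alpha> k * x k powi j))"
  shows "T j = 1 + z * (\<Sum>l=1..m. complex_of_real (w l) * T (j + b l))"
proof -
  let ?P = "laurent_P m w b"
  let ?t = "total_T ?P z"
  let ?w = "\<lambda>l. complex_of_real (w l)"
  \<comment> \<open>The constant solution. With a vanishing denominator, \<open>?t\<close> would be
    \<open>0\<close> by the convention for division and the identity would fail.\<close>
  have t: "1 + z * (?t * ?P 1) = ?t"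
    using nz by (simp add: total_T_def field_simps)
  \<comment> \<open>Exchanging the two sums isolates, for each root, the homogeneous recurrence for
    its powers.\<close>
  have "z * (\<Sum>l=1..m. ?w l * (\<Sum>k\<in>I. \<alpha> k * x k powi (j + b l)))
      = (\<Sum>k\<in>I. \<alpha> k * (z * (\<Sum>l=1..m. ?w l * x k powi (j + b l))))"
    by (subst (2) sum_distrib_left, subst sum.swap) (simp add: sum_distrib_left mult_ac)
  also have "\<dots> = (\<Sum>k\<in>I. \<alpha> k * x k powi j)"
    by (intro sum.cong refl) (simp add: char_solution_shift[OF sol] del: One_nat_def)
  finally have hom: "z * (\<Sum>l=1..m. ?w l * (\<Sum>k\<in>I. \<alpha> k * x k powi (j + b l)))
      = (\<Sum>k\<in>I. \<alpha> k * x k powi j)" .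
  \<comment> \<open>The constant part contributes the sum of the weights, which is
    \<open>?P 1\<close> because every power of \<open>1\<close> is \<open>1\<close>.\<close>
  have "(\<Sum>l=1..m. ?w l * T (j + b l))
      = ?t * (?P 1 - (\<Sum>l=1..m. ?w l * (\<Sum>k\<in>I. \<alpha> k * x k powi (j + b l))))"
    unfolding T_def laurent_P_def[of m w b 1]
    by (simp add: right_diff_distrib sum_subtractf sum_distrib_left mult_ac)
  then have "1 + z * (\<Sum>l=1..m. ?w l * T (j + b l)) = (1 + z * (?t * ?P 1)) - ?t *
      (z * (\<Sum>l=1..m. ?w l * (\<Sum>k\<in>I. \<alpha> k * x k powi (j + b l))))"
    by (simp only: right_diff_distrib mult.left_commute add_diff_eq)
  also have "\<dots> = T j"
    unfolding t hom by (simp add: T_def right_diff_distrib)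
  finally show ?thesis ..
qed

lemma small_solutions_eventually:
  assumes "small_solutions P c X"
  shows "\<forall>\<^sub>F z in at 0. \<forall>l\<in>{1..c}. X l z \<in> char_solutions P z"
proof -
  obtain \<delta> where "\<forall>\<^sub>F z in at 0. bij_betw (\<lambda>l. X l z) {1..c} (char_solutions P z \<inter> ball 0 \<delta>)"
    using assms by (auto simp: small_solutions_def)
  then show ?thesis
    by (rule eventually_mono) (auto dest: bij_betwE)
qed

theorem theorem3:
  fixes m c :: nat
    and b :: "nat \<Rightarrow> int"
    and w :: "nat \<Rightarrow> real"
    and P :: "complex \<Rightarrow> complex"
    and X :: "nat \<Rightarrow> complex \<Rightarrow> complex"
  assumes "m \<ge> 1"
    and "inj_on b {1..m}"
    and "\<And>l. l \<in> {1..m} \<Longrightarrow> w l > 0"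
    and "P = laurent_P m w b"
    and "int c = - Min (b ` {1..m})"
    and "c \<ge> 1"
    and "small_solutions P c X"
  shows "\<exists>r>0.
    (\<forall>z \<in> ball 0 r - {0}. 1 - z * P 1 \<noteq> 0 \<and> (\<forall>l\<in>{1..c}. X l z \<noteq> 0)) \<and>
    (\<forall>(\<alpha> :: nat \<Rightarrow> complex \<Rightarrow> complex) (T :: int \<Rightarrow> complex \<Rightarrow> complex).
       (\<forall>z \<in> ball 0 r - {0}. \<forall>j \<ge> - int c.
          T j z = total_T P z * (1 - (\<Sum>l=1..c. \<alpha> l z * X l z powi j))) \<longrightarrow>
       (\<forall>z \<in> ball 0 r - {0}. \<forall>j \<ge> 0.
          T j z = 1 + z * (\<Sum>l=1..m. complex_of_real (w l) * T (j + b l) z)))"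
proof -
  \<comment> \<open>The denominator of \<open>total_T P z\<close> tends to \<open>1\<close>, so it
    is nonzero near \<open>0\<close>.\<close>
  have "((\<lambda>z. 1 - z * P 1) \<longlongrightarrow> 1 - 0 * P 1) (at 0)"
    by (intro tendsto_intros)
  then have "\<forall>\<^sub>F z in at 0. 1 - z * P 1 \<noteq> 0"
    by (rule tendsto_imp_eventually_ne) simp
  with small_solutions_eventually[OF assms(7)]
  have "\<forall>\<^sub>F z in at 0. 1 - z * P 1 \<noteq> 0 \<and> (\<forall>l\<in>{1..c}. X l z \<in> char_solutions P z)"
    by eventually_elim simp
  \<comment> \<open>The radius is fixed before \<open>\<alpha>\<close> and \<open>T\<close> are
    introduced, so one punctured disc serves all choices of parameters.\<close>
  then obtain r where r: "r > 0"
    and near: "\<And>z. z \<in> ball 0 r - {0} \<Longrightarrow>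
      1 - z * P 1 \<noteq> 0 \<and> (\<forall>l\<in>{1..c}. X l z \<in> char_solutions P z)"
    by (auto simp: eventually_at dist_commute)
  \<comment> \<open>Since \<open>- int c\<close> is the least exponent, the recurrence at
    \<open>j \<ge> 0\<close> only reaches indices where the closed form is assumed.\<close>
  have range: "- int c \<le> j + b l" if "l \<in> {1..m}" "0 \<le> j" for j l
  proof -
    have "Min (b ` {1..m}) \<le> b l"
      using that by simp
    then show ?thesis
      using assms(5) that by linarith
  qed
  have "T j z = 1 + z * (\<Sum>l=1..m. complex_of_real (w l) * T (j + b l) z)"
    if T: "\<forall>z \<in> ball 0 r - {0}. \<forall>j \<ge> - int c.
        T j z = total_T P z * (1 - (\<Sum>l=1..c. \<alpha> l z * X l z powi j))"
      and z: "z \<in> ball 0 r - {0}" and j: "0 \<le> j"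
    for \<alpha> :: "nat \<Rightarrow> complex \<Rightarrow> complex" and T :: "int \<Rightarrow> complex \<Rightarrow> complex" and z j
  proof -
    \<comment> \<open>\<open>?F\<close> is the closed form at every integer index, whereas
      \<open>T\<close> is known only from \<open>- int c\<close> on; the recurrence is proved for
      \<open>?F\<close> and then transferred to \<open>T\<close>.\<close>
    let ?F = "\<lambda>j. total_T P z * (1 - (\<Sum>l=1..c. \<alpha> l z * X l z powi j))"
    have "?F j = 1 + z * (\<Sum>l=1..m. complex_of_real (w l) * ?F (j + b l))"
      unfolding assms(4)
      by (rule recurrence_char_solutions) (use near[OF z] in \<open>auto simp: assms(4)\<close>)
    moreover have "T j z = ?F j"
      using T z j by simp
    moreover have "(\<Sum>l=1..m. complex_of_real (w l) * T (j + b l) z)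
        = (\<Sum>l=1..m. complex_of_real (w l) * ?F (j + b l))"
      using T z j range by (intro sum.cong refl) simp
    ultimately show ?thesis
      by simp
  qed
  moreover have "1 - z * P 1 \<noteq> 0 \<and> (\<forall>l\<in>{1..c}. X l z \<noteq> 0)" if "z \<in> ball 0 r - {0}" for z
    using near[OF that] by (auto simp: char_solutions_def)
  ultimately show ?thesis
    using r by blast
qed

end
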